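(* The joint placement and power-control problem $$\min_{\mathbf X,\{\mathbf p_\ell^{(t)},\eta_\ell^{(t)}\}}\ \sum_{\ell=1}^{L} a_\ell\,\mathbb E\Big[\mathrm{MSE}_\ell^{(t)}\big(\mathbf X,\mathbf p_\ell^{(t)},\eta_\ell^{(t)}\big)\Big]$$ subject to $\mathbf X$ being a feasible placement, $0\le p_{\ell,i}^{(t)}\le P_{\ell,i}(\mathbf X)$ for all $i\in S_\ell^{(t)}$, and $\eta_\ell^{(t)}>0$, for all $\ell,t$ (where the variables $\mathbf p_\ell^{(t)},\eta_\ell^{(t)}$ may depend on the instantaneous realization) has the same optimal objective value as the nested problem $$\min_{\mathbf X\ \text{feasible}}\ \sum_{\ell=1}^{L} a_\ell\,\mathbb E\Big[\mathrm{MSE}_\ell^{(t),\star}(\mathbf X)\Big],$$ where, for each realization, $\mathrm{MSE}_\ell^{(t),\star}(\mathbf X)$ is the optimal value of the inner per-aggregation problem $$\min_{\mathbf p_\ell^{(t)},\,\eta_\ell^{(t)}}\ \mathrm{MSE}_\ell^{(t)}\big(\mathbf X,\mathbf p_\ell^{(t)},\eta_\ell^{(t)}\big)\quad\text{s.t. } 0\le p_{\ell,i}^{(t)}\le P_{\ell,i}(\mathbf X)\ (i\in S_\ell^{(t)}),\quad \eta_\ell^{(t)}>0 .$$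
   Context: Let $\mathcal L=\{1,\dots,L\}$ (layers), $\mathcal I=\{1,\dots,I\}$ (experts per layer), $\mathcal M=\{1,\dots,M\}$ (devices) with $M\ge LI$. A feasible placement is $\mathbf X=\{x_{\ell,i,m}\in\{0,1\}\}_{\ell\in\mathcal L,i\in\mathcal I,m\in\mathcal M}$ with $\sum_{m}x_{\ell,i,m}=1$ for all $(\ell,i)$ and $\sum_{\ell,i}x_{\ell,i,m}\le 1$ for all $m$. Constants: $a_\ell\ge0$, $c_\ell>0$, $\sigma^2>0$, power budgets $P_m>0$. For a (random) token $t$, the realization consists of the random activated sets $S_\ell^{(t)}\subseteq\mathcal I$ with $|S_\ell^{(t)}|=K\ge1$, random gating scores $g_{\ell,i}^{(t)}\in(0,1)$, and random nonzero complex channel coefficients $h_m^{(t)}$; $\mathbb E$ is expectation over this realization (expectations of nonnegative quantities, in $[0,\infty]$). The placement $\mathbf X$ is deterministic (fixed before the realization), whereas $\mathbf p_\ell^{(t)}=\{p_{\ell,i}^{(t)}:i\in S_\ell^{(t)}\}$ and $\eta_\ell^{(t)}$ are recourse variables, i.e. (measurable) functions of the realization, with no coupling constraints across layers, tokens or realizations. Placement-induced quantities: $H_{\ell,i}^{(t)}(\mathbf X)=\sum_{m}x_{\ell,i,m}|h_m^{(t)}|$ and $P_{\ell,i}(\mathbf X)=\sum_m x_{\ell,i,m}P_m$. The layer-wise error is $$\mathrm{MSE}_\ell^{(t)}(\mathbf X,\mathbf p_\ell^{(t)},\eta_\ell^{(t)})=c_\ell^2\Big[\sum_{i\in S_\ell^{(t)}}\Big(\frac{H_{\ell,i}^{(t)}(\mathbf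 X)\sqrt{p_{\ell,i}^{(t)}}}{\eta_\ell^{(t)}}-g_{\ell,i}^{(t)}\Big)^2+\frac{\sigma^2}{(\eta_\ell^{(t)})^2}\Big].$$ "Optimal objective value" means the infimum of the objective over the feasible set. *)

theory Defs
  imports "HOL-Probability.Probability"
begin

text \<open>
  A realization \<open>(S, g, h)\<close> collects the activated expert sets \<open>S l\<close>, the gating scores
  \<open>g l i\<close> and the channel coefficients \<open>h m\<close>. Layers, experts and devices are indexed by
  \<open>{1..L}\<close>, \<open>{1..I}\<close> and \<open>{1..M}\<close>.
\<close>

type_synonym realization = "(nat \<Rightarrow> nat set) \<times> (nat \<Rightarrow> nat \<Rightarrow> real) \<times> (nat \<Rightarrow> complex)"

abbreviation act :: "realization \<Rightarrow> nat \<Rightarrow> nat set" where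
  "act r \<equiv> fst r"

abbreviation gate :: "realization \<Rightarrow> nat \<Rightarrow> nat \<Rightarrow> real" where
  "gate r \<equiv> fst (snd r)"

abbreviation chan :: "realization \<Rightarrow> nat \<Rightarrow> complex" where
  "chan r \<equiv> snd (snd r)"

text \<open>
  The pointwise constraints \<open>S l \<subseteq> {1..I}\<close>, \<open>card (S l) = K\<close>, \<open>0 < g l i < 1\<close> and \<open>h m \<noteq> 0\<close>
  are built into the factor spaces, so they hold for every point of the space.
\<close>

definition realization_space :: "nat \<Rightarrow> nat \<Rightarrow> nat \<Rightarrow> nat \<Rightarrow> realization measure" where
  "realization_space L I M K =
     (\<Pi>\<^sub>M l\<in>{1..L}. count_space {A. A \<subseteq> {1..I} \<and> card A = K}) \<Otimes>\<^sub>M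
     ((\<Pi>\<^sub>M l\<in>{1..L}. \<Pi>\<^sub>M i\<in>{1..I}. restrict_space borel {0<..<1}) \<Otimes>\<^sub>M
      (\<Pi>\<^sub>M m\<in>{1..M}. restrict_space borel (- {0})))"

type_synonym placement = "nat \<Rightarrow> nat \<Rightarrow> nat \<Rightarrow> real"

definition feasible_placements :: "nat \<Rightarrow> nat \<Rightarrow> nat \<Rightarrow> placement set" where
  "feasible_placements L I M =
     {X. (\<forall>l\<in>{1..L}. \<forall>i\<in>{1..I}. \<forall>m\<in>{1..M}. X l i m \<in> {0, 1}) \<and>
         (\<forall>l\<in>{1..L}. \<forall>i\<in>{1..I}. (\<Sum>m\<in>{1..M}. X l i m) = 1) \<and>
         (\<forall>m\<in>{1..M}. (\<Sum>l\<in>{1..L}. \<Sum>i\<in>{1..I}. X l i m) \<le> 1)}"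

definition placed_gain :: "nat \<Rightarrow> placement \<Rightarrow> realization \<Rightarrow> nat \<Rightarrow> nat \<Rightarrow> real" where
  "placed_gain M X r l i = (\<Sum>m\<in>{1..M}. X l i m * cmod (chan r m))"

definition placed_power :: "nat \<Rightarrow> (nat \<Rightarrow> real) \<Rightarrow> placement \<Rightarrow> nat \<Rightarrow> nat \<Rightarrow> real" where
  "placed_power M P X l i = (\<Sum>m\<in>{1..M}. X l i m * P m)"

definition mse ::
  "nat \<Rightarrow> (nat \<Rightarrow> real) \<Rightarrow> real \<Rightarrow> placement \<Rightarrow> realization \<Rightarrow> nat \<Rightarrow> (nat \<Rightarrow> real) \<Rightarrow> real \<Rightarrow> real"
where
  "mse M c \<sigma> X r l p \<eta> =
     (c l)\<^sup>2 * ((\<Sum>i\<in>act r l. (placed_gain M X r l i * sqrt (p i) / \<eta> - gate r l i)\<^sup>2) + \<sigma>\<^sup>2 / \<eta>\<^sup>2)"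

definition inner_feasible ::
  "nat \<Rightarrow> (nat \<Rightarrow> real) \<Rightarrow> placement \<Rightarrow> realization \<Rightarrow> nat \<Rightarrow> ((nat \<Rightarrow> real) \<times> real) set"
where
  "inner_feasible M P X r l =
     {(p, \<eta>). (\<forall>i\<in>act r l. 0 \<le> p i \<and> p i \<le> placed_power M P X l i) \<and> 0 < \<eta>}"

text \<open>
  All optimal values are infima in \<open>[0,\<infinity>]\<close>; since \<^const>\<open>mse\<close> is nonnegative, the coercion
  \<^const>\<open>ennreal\<close> loses nothing.
\<close>

definition mse_star ::
  "nat \<Rightarrow> (nat \<Rightarrow> real) \<Rightarrow> real \<Rightarrow> (nat \<Rightarrow> real) \<Rightarrow> placement \<Rightarrow> realization \<Rightarrow> nat \<Rightarrow> ennreal"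
where
  "mse_star M c \<sigma> P X r l =
     (INF (p, \<eta>)\<in>inner_feasible M P X r l. ennreal (mse M c \<sigma> X r l p \<eta>))"

text \<open>
  Recourse variables are measurable functions of the realization. The value \<open>p l i r\<close> is
  a decision variable only when \<open>i \<in> act r l\<close>; otherwise it is neither constrained nor used.
  The placement does not depend on the realization.
\<close>

definition joint_feasible ::
  "nat \<Rightarrow> nat \<Rightarrow> nat \<Rightarrow> nat \<Rightarrow> (nat \<Rightarrow> real) \<Rightarrow>
   (placement \<times> (nat \<Rightarrow> nat \<Rightarrow> realization \<Rightarrow> real) \<times> (nat \<Rightarrow> realization \<Rightarrow> real)) set"
where
  "joint_feasible L I M K P =
     {(X, p, \<eta>). X \<in> feasible_placements L I M \<and>
        (\<forall>l\<in>{1..L}. \<forall>i\<in>{1..I}. p l i \<in> borel_measurable (realization_space L I M K)) \<and>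
        (\<forall>l\<in>{1..L}. \<eta> l \<in> borel_measurable (realization_space L I M K)) \<and>
        (\<forall>l\<in>{1..L}. \<forall>r\<in>space (realization_space L I M K).
           (\<forall>i\<in>act r l. 0 \<le> p l i r \<and> p l i r \<le> placed_power M P X l i) \<and> 0 < \<eta> l r)}"

text \<open>
  In both objectives \<open>\<rho>\<close> is the random realization on the probability space \<open>\<Omega>\<close>.
\<close>

definition joint_objective ::
  "'w measure \<Rightarrow> ('w \<Rightarrow> realization) \<Rightarrow> nat \<Rightarrow> nat \<Rightarrow> (nat \<Rightarrow> real) \<Rightarrow> (nat \<Rightarrow> real) \<Rightarrow> real \<Rightarrow>
   placement \<Rightarrow> (nat \<Rightarrow> nat \<Rightarrow> realization \<Rightarrow> real) \<Rightarrow> (nat \<Rightarrow> realization \<Rightarrow> real) \<Rightarrow> ennreal"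
where
  "joint_objective \<Omega> \<rho> L M a c \<sigma> X p \<eta> =
     (\<Sum>l\<in>{1..L}. ennreal (a l) *
        (\<integral>\<^sup>+ \<omega>. ennreal (mse M c \<sigma> X (\<rho> \<omega>) l (\<lambda>i. p l i (\<rho> \<omega>)) (\<eta> l (\<rho> \<omega>))) \<partial>\<Omega>))"

definition nested_objective ::
  "'w measure \<Rightarrow> ('w \<Rightarrow> realization) \<Rightarrow> nat \<Rightarrow> nat \<Rightarrow> (nat \<Rightarrow> real) \<Rightarrow> (nat \<Rightarrow> real) \<Rightarrow> real \<Rightarrow>
   (nat \<Rightarrow> real) \<Rightarrow> placement \<Rightarrow> ennreal"
where
  "nested_objective \<Omega> \<rho> L M a c \<sigma> P X =
     (\<Sum>l\<in>{1..L}. ennreal (a l) * (\<integral>\<^sup>+ \<omega>. mse_star M c \<sigma> P X (\<rho> \<omega>) l \<partial>\<Omega>))"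

end

theory Submission
  imports Defs
begin

text \<open>
  Exchanging infimum and expectation needs measurable near-optimal recourse. For fixed \<open>\<eta>\<close> the
  inner problem separates over experts and has an explicit minimiser, truncated channel inversion.
  What remains is continuous in \<open>\<eta>\<close>, so rational values of \<open>\<eta>\<close> suffice, and the least index
  in an enumeration of the positive rationals that is \<open>\<epsilon>\<close>-optimal depends measurably on the
  realization.
\<close>

section \<open>Countable infima and measurable selection\<close>

text \<open>By continuity a strict upper bound on \<open>f x\<close> persists just to the right of
  \<open>x\<close>, where there is a rational. Approaching from the right keeps that rational
  positive.\<close>

lemma INF_positive_rationals:
  fixes f :: "real \<Rightarrow> ennreal"
  assumes "continuous_on {0<..} f"
  shows "(INF x\<in>\<rat> \<inter> {0<..}. f x) = (INF x\<in>{0<..}. f x)"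
proof (rule antisym)
  show "(INF x\<in>\<rat> \<inter> {0<..}. f x) \<le> (INF x\<in>{0<..}. f x)"
  proof (rule INF_greatest, rule ccontr)
    fix x :: real assume x: "x \<in> {0<..}" and "\<not> (INF x\<in>\<rat> \<inter> {0<..}. f x) \<le> f x"
    then have less: "f x < (INF x\<in>\<rat> \<inter> {0<..}. f x)" by simp
    have "isCont f x" using assms x by (simp add: continuous_on_eq_continuous_at)
    then have "(f \<longlongrightarrow> f x) (at x)" by (simp add: isCont_def)
    then have "(f \<longlongrightarrow> f x) (at_right x)"
      by (rule filterlim_mono) (auto simp: at_le)
    then have "\<forall>\<^sub>F y in at_right x. f y < (INF x\<in>\<rat> \<inter> {0<..}. f x)"
      using less by (rule order_tendstoD)
    then obtain b where "x < b" and b: "\<And>y. x < y \<Longrightarrow> y < b \<Longrightarrow> f y < (INF x\<in>\<rat> \<inter> {0<..}. f x)"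
      by (auto simp: eventually_at_right_field)
    obtain q where q: "q \<in> \<rat>" "x < q" "q < b"
      using Rats_dense_in_real[OF \<open>x < b\<close>] by blast
    then have "(INF x\<in>\<rat> \<inter> {0<..}. f x) \<le> f q" using x by (intro INF_lower) auto
    with b[of q] q show False by simp
  qed
qed (auto intro: INF_superset_mono)

text \<open>The infimum need not be attained, but with slack \<open>\<epsilon>\<close> some index
  always succeeds. Taking the least one removes arbitrary choice, so measurability survives.\<close>

lemma measurable_near_minimizer:
  fixes f :: "nat \<Rightarrow> 'a \<Rightarrow> ennreal"
  assumes [measurable]: "\<And>n. f n \<in> borel_measurable M" and "0 < \<epsilon>"
  obtains N where "N \<in> measurable M (count_space UNIV)"
    and "\<And>x. f (N x) x \<le> (INF n. f n x) + \<epsilon>"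
proof
  let ?N = "\<lambda>x. LEAST n. f n x \<le> (INF n. f n x) + \<epsilon>"
  \<comment> \<open>The least index is determined by countably many predicates, each comparing two
    measurable functions; the infimum is measurable because it is countable.\<close>
  show "?N \<in> measurable M (count_space UNIV)" by measurable
  show "f (?N x) x \<le> (INF n. f n x) + \<epsilon>" for x
  proof (rule LeastI_ex)
    show "\<exists>n. f n x \<le> (INF n. f n x) + \<epsilon>"
    proof (cases "(INF n. f n x) = \<top>")
      \<comment> \<open>Finiteness makes adding \<open>\<epsilon>\<close> a strict increase, so some
        index lies below the bound. For an infinite infimum every index works.\<close>
      case False
      then have "(INF n. f n x) < (INF n. f n x) + \<epsilon>"
        using \<open>0 < \<epsilon>\<close> by (simp add: ennreal_add_left_cancel_less less_top)
      then obtain n where "f n x < (INF n. f n x) + \<epsilon>" by (auto simp only: INF_less_iff)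
      then show ?thesis by (blast intro: less_imp_le)
    qed simp
  qed
qed

section \<open>The inner problem and truncated channel inversion\<close>

text \<open>The received amplitude \<open>H * sqrt p / \<eta>\<close> increases with
  \<open>p\<close> and equals \<open>g\<close> at \<open>p = (g / H * \<eta>)\<^sup>2\<close>. If
  the budget allows this power, the residual vanishes; otherwise full power comes closest to
  \<open>g\<close> from below. For \<open>H = 0\<close> the power has no effect.\<close>

lemma truncated_inversion_optimal:
  fixes H g P p \<eta> :: real
  assumes "0 \<le> H" "0 \<le> g" "0 < \<eta>" "0 \<le> p" "p \<le> P"
  shows "(H * sqrt (min P ((g / H * \<eta>)\<^sup>2)) / \<eta> - g)\<^sup>2 \<le> (H * sqrt p / \<eta> - g)\<^sup>2"
proof (cases "H = 0")
  case False
  show ?thesis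
  proof (cases "P \<le> (g / H * \<eta>)\<^sup>2")
    case True
    \<comment> \<open>When the cap binds, all admissible amplitudes stay at or below
      \<open>g\<close>, so the squared residuals are ordered by amplitude in reverse.\<close>
    have "sqrt P \<le> g / H * \<eta>" using True assms by (simp add: real_le_lsqrt)
    then have "H * sqrt P / \<eta> \<le> g" using assms False by (simp add: field_simps)
    moreover have "H * sqrt p / \<eta> \<le> H * sqrt P / \<eta>"
      using assms by (intro divide_right_mono mult_left_mono) auto
    ultimately show ?thesis using True by (simp flip: abs_le_square_iff)
  qed (use assms False in simp)
qed simp

text \<open>The factor \<open>gate / gain * \<eta>\<close> solves gain * sqrt p /
  \<open>\<eta>\<close> = gate for sqrt p. At zero gain the quotient defaults to 0, and there the
  power does not influence the error.\<close>

definition inversion_power ::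
  "nat \<Rightarrow> (nat \<Rightarrow> real) \<Rightarrow> placement \<Rightarrow> realization \<Rightarrow> nat \<Rightarrow> real \<Rightarrow> nat \<Rightarrow> real"
where
  "inversion_power M P X r l \<eta> i =
     min (placed_power M P X l i) ((gate r l i / placed_gain M X r l i * \<eta>)\<^sup>2)"

lemma mse_inversion_power_le:
  assumes "(p, \<eta>) \<in> inner_feasible M P X r l"
    and "\<And>i. i \<in> act r l \<Longrightarrow> 0 \<le> placed_gain M X r l i"
    and "\<And>i. i \<in> act r l \<Longrightarrow> 0 \<le> gate r l i"
  shows "mse M c \<sigma> X r l (inversion_power M P X r l \<eta>) \<eta> \<le> mse M c \<sigma> X r l p \<eta>"
  using assms unfolding mse_def inversion_power_def inner_feasible_def
  by (intro mult_left_mono add_mono sum_mono truncated_inversion_optimal) auto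

lemma inversion_power_feasible:
  assumes "\<And>i. i \<in> act r l \<Longrightarrow> 0 \<le> placed_power M P X l i" and "0 < \<eta>"
  shows "(inversion_power M P X r l \<eta>, \<eta>) \<in> inner_feasible M P X r l"
  using assms by (auto simp: inner_feasible_def inversion_power_def)

text \<open>Inserting the optimal powers eliminates \<open>p\<close> and leaves a problem in the
  single variable \<open>\<eta>\<close>, which continuity restricts to a countable set. This makes
  the inner optimum accessible to measure theory.\<close>

lemma mse_star_eq_INF_rationals:
  assumes "\<And>i. i \<in> act r l \<Longrightarrow> 0 \<le> placed_gain M X r l i"
    and "\<And>i. i \<in> act r l \<Longrightarrow> 0 \<le> gate r l i"
    and "\<And>i. i \<in> act r l \<Longrightarrow> 0 \<le> placed_power M P X l i"
  shows "mse_star M c \<sigma> P X r l =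
    (INF \<eta>\<in>\<rat> \<inter> {0<..}. ennreal (mse M c \<sigma> X r l (inversion_power M P X r l \<eta>) \<eta>))"
proof -
  have "mse_star M c \<sigma> P X r l =
    (INF \<eta>\<in>{0<..}. ennreal (mse M c \<sigma> X r l (inversion_power M P X r l \<eta>) \<eta>))"
    unfolding mse_star_def
  proof (rule antisym)
    show "(INF (p, \<eta>)\<in>inner_feasible M P X r l. ennreal (mse M c \<sigma> X r l p \<eta>)) \<le>
      (INF \<eta>\<in>{0<..}. ennreal (mse M c \<sigma> X r l (inversion_power M P X r l \<eta>) \<eta>))"
    proof (rule INF_greatest)
      fix \<eta> :: real assume "\<eta> \<in> {0<..}"
      then have "(inversion_power M P X r l \<eta>, \<eta>) \<in> inner_feasible M P X r l"
        using inversion_power_feasible assms(3) by simp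
      then show "(INF (p, \<eta>)\<in>inner_feasible M P X r l. ennreal (mse M c \<sigma> X r l p \<eta>)) \<le>
          ennreal (mse M c \<sigma> X r l (inversion_power M P X r l \<eta>) \<eta>)"
        by (rule INF_lower2) simp
    qed
    show "(INF \<eta>\<in>{0<..}. ennreal (mse M c \<sigma> X r l (inversion_power M P X r l \<eta>) \<eta>)) \<le>
      (INF (p, \<eta>)\<in>inner_feasible M P X r l. ennreal (mse M c \<sigma> X r l p \<eta>))"
    proof (rule INF_greatest, clarsimp)
      fix p \<eta> assume *: "(p, \<eta>) \<in> inner_feasible M P X r l"
      then have "\<eta> \<in> {0<..}" by (simp add: inner_feasible_def)
      then show "(INF \<eta>\<in>{0<..}. ennreal (mse M c \<sigma> X r l (inversion_power M P X r l \<eta>) \<eta>))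
          \<le> ennreal (mse M c \<sigma> X r l p \<eta>)"
        by (rule INF_lower2) (intro ennreal_leI mse_inversion_power_le * assms)
    qed
  qed
  \<comment> \<open>After unfolding, \<open>\<eta>\<close> enters only through continuous operations
    and through division by \<open>\<eta>\<close> or its square, which are nonzero on the positive
    half-line.\<close>
  also have "\<dots> = (INF \<eta>\<in>\<rat> \<inter> {0<..}. ennreal (mse M c \<sigma> X r l (inversion_power M P X r l \<eta>) \<eta>))"
    unfolding mse_def inversion_power_def
    by (intro INF_positive_rationals[symmetric] continuous_on_ennreal continuous_intros) auto
  finally show ?thesis .
qed

section \<open>Coordinates of the realization space and measurability\<close>

lemma act_subset:
  assumes "r \<in> space (realization_space L I M K)" "l \<in> {1..L}"
  shows "act r l \<subseteq> {1..I}"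
proof -
  have "fst r \<in> (\<Pi>\<^sub>E l\<in>{1..L}. {A. A \<subseteq> {1..I} \<and> card A = K})"
    using assms(1)
    by (simp add: realization_space_def space_pair_measure space_PiM mem_Times_iff)
  from PiE_mem[OF this assms(2)] show ?thesis by simp
qed

lemma gate_pos:
  assumes "r \<in> space (realization_space L I M K)" "l \<in> {1..L}" "i \<in> {1..I}"
  shows "0 < gate r l i"
proof -
  have "gate r \<in> (\<Pi>\<^sub>E l\<in>{1..L}. \<Pi>\<^sub>E i\<in>{1..I}. {0<..<1})"
    using assms(1)
    by (simp add: realization_space_def space_pair_measure space_PiM mem_Times_iff
        space_restrict_space)
  from PiE_mem[OF PiE_mem[OF this assms(2)] assms(3)] show ?thesis by simp
qed

lemma measurable_act:
  assumes "l \<in> {1..L}"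
  shows "Measurable.pred (realization_space L I M K) (\<lambda>r. i \<in> act r l)"
proof -
  have "(\<lambda>r. act r l) \<in> measurable (realization_space L I M K)
      (count_space {A. A \<subseteq> {1..I} \<and> card A = K})"
    unfolding realization_space_def
    by (rule measurable_compose[OF measurable_fst measurable_component_singleton[OF assms]])
  \<comment> \<open>The factor is discrete, so membership of \<open>i\<close> is a measurable
    predicate on it.\<close>
  then show ?thesis by (rule measurable_compose) simp
qed

lemma measurable_gate:
  assumes "l \<in> {1..L}" "i \<in> {1..I}"
  shows "(\<lambda>r. gate r l i) \<in> borel_measurable (realization_space L I M K)"
proof -
  have "(\<lambda>r. gate r l i) \<in> measurable (realization_space L I M K)
      (restrict_space borel {0<..<1})"
    unfolding realization_space_def
    by (intro measurable_compose[OF measurable_snd] measurable_compose[OF measurable_fst]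
          measurable_compose[OF measurable_component_singleton[OF assms(1)]]
          measurable_component_singleton assms(2))
  then show ?thesis by (simp add: measurable_restrict_space2_iff)
qed

lemma measurable_chan:
  assumes "m \<in> {1..M}"
  shows "(\<lambda>r. chan r m) \<in> borel_measurable (realization_space L I M K)"
proof -
  have "(\<lambda>r. chan r m) \<in> measurable (realization_space L I M K) (restrict_space borel (- {0}))"
    unfolding realization_space_def
    by (intro measurable_compose[OF measurable_snd] measurable_compose[OF measurable_snd]
          measurable_component_singleton assms)
  then show ?thesis by (simp add: measurable_restrict_space2_iff)
qed

lemma measurable_placed_gain:
  "(\<lambda>r. placed_gain M X r l i) \<in> borel_measurable (realization_space L I M K)"
  unfolding placed_gain_def
  by (intro borel_measurable_sum borel_measurable_times borel_measurable_const
        measurable_compose[OF measurable_chan borel_measurable_norm])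

text \<open>Letting \<open>\<eta>\<close> depend on the realization covers both a fixed scale and a
  selected recourse.\<close>

lemma measurable_inversion_power:
  assumes "l \<in> {1..L}" "i \<in> {1..I}"
    and [measurable]: "\<eta> \<in> borel_measurable (realization_space L I M K)"
  shows "(\<lambda>r. inversion_power M P X r l (\<eta> r) i) \<in> borel_measurable (realization_space L I M K)"
proof -
  note [measurable] = measurable_gate[OF assms(1,2)] measurable_placed_gain
  show ?thesis unfolding inversion_power_def by measurable
qed

lemma measurable_mse_inversion_power:
  assumes l: "l \<in> {1..L}"
  shows "(\<lambda>r. mse M c \<sigma> X r l (inversion_power M P X r l \<eta>) \<eta>)
    \<in> borel_measurable (realization_space L I M K)" (is "?f \<in> _")
proof -
  let ?T = "\<lambda>r i. (placed_gain M X r l i * sqrt (inversion_power M P X r l \<eta> i) / \<eta> - gate r l i)\<^sup>2"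
  \<comment> \<open>The index set of the sum is random. Summing over all experts with inactive terms
    set to 0 gives a fixed finite sum of measurable functions.\<close>
  have "?f r = (c l)\<^sup>2 * ((\<Sum>i\<in>{1..I}. if i \<in> act r l then ?T r i else 0) + \<sigma>\<^sup>2 / \<eta>\<^sup>2)"
    if "r \<in> space (realization_space L I M K)" for r
    using act_subset[OF that l] by (simp add: mse_def sum.inter_restrict[symmetric] Int_absorb1)
  moreover have "(\<lambda>r. if i \<in> act r l then ?T r i else 0)
      \<in> borel_measurable (realization_space L I M K)" if i: "i \<in> {1..I}" for i
  proof -
    note [measurable] = measurable_act[OF l] measurable_gate[OF l i] measurable_placed_gain
      measurable_inversion_power[OF l i]
    show ?thesis by measurable
  qed
  then have "(\<lambda>r. (c l)\<^sup>2 * ((\<Sum>i\<in>{1..I}. if i \<in> act r l then ?T r i else 0) + \<sigma>\<^sup>2 / \<eta>\<^sup>2))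
      \<in> borel_measurable (realization_space L I M K)"
    by (intro borel_measurable_times borel_measurable_add borel_measurable_sum
          borel_measurable_const)
  ultimately show ?thesis by (simp cong: measurable_cong)
qed

section \<open>Measurable near-optimal recourse for a fixed placement\<close>

lemma feasible_placement_nonneg:
  assumes "X \<in> feasible_placements L I M" "l \<in> {1..L}" "i \<in> {1..I}" "m \<in> {1..M}"
  shows "0 \<le> X l i m"
proof -
  have "X l i m \<in> {0, 1}" using assms unfolding feasible_placements_def by blast
  then show ?thesis by auto
qed

lemma placed_gain_nonneg:
  assumes "X \<in> feasible_placements L I M" "l \<in> {1..L}" "i \<in> {1..I}"
  shows "0 \<le> placed_gain M X r l i"
  unfolding placed_gain_def using feasible_placement_nonneg[OF assms]
  by (intro sum_nonneg mult_nonneg_nonneg) auto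

lemma placed_power_nonneg:
  assumes "X \<in> feasible_placements L I M" "l \<in> {1..L}" "i \<in> {1..I}"
    and "\<And>m. m \<in> {1..M} \<Longrightarrow> 0 \<le> P m"
  shows "0 \<le> placed_power M P X l i"
  unfolding placed_power_def using feasible_placement_nonneg[OF assms(1-3)] assms(4)
  by (intro sum_nonneg mult_nonneg_nonneg)

text \<open>Along an enumeration of the positive rationals, \<open>mse_star\<close> is a countable
  infimum of measurable functions, and an index can be selected measurably. Only the scale has to be
  selected: the powers then follow by truncated inversion.\<close>

lemma measurable_near_optimal_recourse:
  fixes K :: nat and \<epsilon> :: ennreal
  assumes X: "X \<in> feasible_placements L I M" and P: "\<And>m. m \<in> {1..M} \<Longrightarrow> 0 \<le> P m"
    and l: "l \<in> {1..L}" and "0 < \<epsilon>"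
  defines "R \<equiv> realization_space L I M K"
  shows "(\<lambda>r. mse_star M c \<sigma> P X r l) \<in> borel_measurable R" (is ?star)
    and "\<exists>\<eta>. \<eta> \<in> borel_measurable R \<and> (\<forall>r\<in>space R. 0 < \<eta> r \<and>
      ennreal (mse M c \<sigma> X r l (inversion_power M P X r l (\<eta> r)) (\<eta> r))
        \<le> mse_star M c \<sigma> P X r l + \<epsilon>)" (is ?recourse)
proof -
  define Q where "Q = from_nat_into (\<rat> \<inter> {0<..} :: real set)"
  define f where "f n r = ennreal (mse M c \<sigma> X r l (inversion_power M P X r l (Q n)) (Q n))" for n r
  \<comment> \<open>A nonempty countable set is exactly the range of its
    \<open>from_nat_into\<close> enumeration.\<close>
  have "(1 :: real) \<in> \<rat> \<inter> {0<..}" by simp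
  then have nonempty: "\<rat> \<inter> {0<..} \<noteq> ({} :: real set)" by blast
  have range_Q: "range Q = \<rat> \<inter> {0<..}"
    unfolding Q_def using nonempty by (simp add: range_from_nat_into countable_rat countable_Int1)
  have f [measurable]: "f n \<in> borel_measurable R" for n
    unfolding f_def R_def
    by (rule measurable_compose[OF measurable_mse_inversion_power[OF l] measurable_ennreal])
  have star: "mse_star M c \<sigma> P X r l = (INF n. f n r)" if r: "r \<in> space R" for r
  proof -
    note r = r[unfolded R_def]
    have I: "i \<in> {1..I}" if "i \<in> act r l" for i
      using act_subset[OF r l] that by blast
    have "mse_star M c \<sigma> P X r l =
        (INF \<eta>\<in>range Q. ennreal (mse M c \<sigma> X r l (inversion_power M P X r l \<eta>) \<eta>))"
      unfolding range_Q
      using placed_gain_nonneg[OF X l I] gate_pos[OF r l I, THEN less_imp_le]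
        placed_power_nonneg[OF X l I P]
      by (rule mse_star_eq_INF_rationals)
    then show ?thesis by (simp add: f_def image_image)
  qed
  have "(\<lambda>r. INF n. f n r) \<in> borel_measurable R" by measurable
  \<comment> \<open>The countable formula is established only on the space of \<open>R\<close>,
    which is all that measurability sees.\<close>
  then show ?star by (subst measurable_cong[OF star])
  obtain N where N: "N \<in> measurable R (count_space UNIV)"
    and N_le: "\<And>r. f (N r) r \<le> (INF n. f n r) + \<epsilon>"
    by (rule measurable_near_minimizer[of f R \<epsilon>]) (use f \<open>0 < \<epsilon>\<close> in auto)
  show ?recourse
  proof (intro exI[of _ "\<lambda>r. Q (N r)"] conjI ballI)
    show "(\<lambda>r. Q (N r)) \<in> borel_measurable R" by (rule measurable_compose[OF N]) simp
    show "0 < Q (N r)" for r using range_Q by (metis Int_iff greaterThan_iff rangeI)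
    show "ennreal (mse M c \<sigma> X r l (inversion_power M P X r l (Q (N r))) (Q (N r)))
        \<le> mse_star M c \<sigma> P X r l + \<epsilon>" if "r \<in> space R" for r
      using N_le[of r] star[OF that] by (simp add: f_def)
  qed
qed

section \<open>Comparing the joint and nested objectives\<close>

text \<open>At each realization the recourse values are a candidate for the inner problem;
  integrating the pointwise bound preserves it.\<close>

lemma nested_le_joint_objective:
  assumes "(X, p, \<eta>) \<in> joint_feasible L I M K P"
    and "\<rho> \<in> measurable \<Omega> (realization_space L I M K)"
  shows "nested_objective \<Omega> \<rho> L M a c \<sigma> P X \<le> joint_objective \<Omega> \<rho> L M a c \<sigma> X p \<eta>"
  unfolding nested_objective_def joint_objective_def
proof (intro sum_mono mult_left_mono nn_integral_mono)
  fix l \<omega> assume l: "l \<in> {1..L}" and "\<omega> \<in> space \<Omega>"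
  then have "\<rho> \<omega> \<in> space (realization_space L I M K)" using assms(2) by (simp add: measurable_space)
  then have "(\<lambda>i. p l i (\<rho> \<omega>), \<eta> l (\<rho> \<omega>)) \<in> inner_feasible M P X (\<rho> \<omega>) l"
    using assms(1) l by (auto simp: joint_feasible_def inner_feasible_def)
  then show "mse_star M c \<sigma> P X (\<rho> \<omega>) l
      \<le> ennreal (mse M c \<sigma> X (\<rho> \<omega>) l (\<lambda>i. p l i (\<rho> \<omega>)) (\<eta> l (\<rho> \<omega>)))"
    unfolding mse_star_def by (rule INF_lower2) simp
qed simp

text \<open>No constraint couples the layers, so a near-optimal recourse can be chosen separately
  for each. The slacks add up with weights \<open>a l\<close>, so one common slack
  \<open>\<delta>\<close> is scaled to keep the total within \<open>\<epsilon>\<close>.\<close>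

lemma joint_le_nested_objective:
  fixes \<epsilon> :: real
  assumes X: "X \<in> feasible_placements L I M" and P: "\<And>m. m \<in> {1..M} \<Longrightarrow> 0 \<le> P m"
    and a: "\<And>l. l \<in> {1..L} \<Longrightarrow> 0 \<le> a l" and "0 < \<epsilon>"
    and "prob_space \<Omega>" and \<rho> [measurable]: "\<rho> \<in> measurable \<Omega> (realization_space L I M K)"
  obtains p \<eta> where "(X, p, \<eta>) \<in> joint_feasible L I M K P"
    and "joint_objective \<Omega> \<rho> L M a c \<sigma> X p \<eta> \<le> nested_objective \<Omega> \<rho> L M a c \<sigma> P X + ennreal \<epsilon>"
proof -
  interpret prob_space \<Omega> by fact
  let ?R = "realization_space L I M K"
  \<comment> \<open>The summand 1 keeps the denominator positive when all weights vanish.\<close>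
  define \<delta> where "\<delta> = \<epsilon> / (1 + sum a {1..L})"
  have sum_a: "0 \<le> sum a {1..L}" using a by (rule sum_nonneg)
  then have "0 < \<delta>" and \<delta>: "sum a {1..L} * \<delta> \<le> \<epsilon>"
    using \<open>0 < \<epsilon>\<close> by (auto simp: \<delta>_def field_simps)
  then have "0 < ennreal \<delta>" by simp
  note recourse = measurable_near_optimal_recourse[where K = K and c = c and \<sigma> = \<sigma>,
    OF X P _ this, simplified]
  have "\<forall>l\<in>{1..L}. \<exists>\<eta>. \<eta> \<in> borel_measurable ?R \<and> (\<forall>r\<in>space ?R. 0 < \<eta> r \<and>
      ennreal (mse M c \<sigma> X r l (inversion_power M P X r l (\<eta> r)) (\<eta> r))
        \<le> mse_star M c \<sigma> P X r l + ennreal \<delta>)"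
    using recourse(2) by simp
  then obtain \<eta> where \<eta>: "\<And>l. l \<in> {1..L} \<Longrightarrow> \<eta> l \<in> borel_measurable ?R"
    and pos: "\<And>l r. l \<in> {1..L} \<Longrightarrow> r \<in> space ?R \<Longrightarrow> 0 < \<eta> l r"
    and le: "\<And>l r. l \<in> {1..L} \<Longrightarrow> r \<in> space ?R \<Longrightarrow>
      ennreal (mse M c \<sigma> X r l (inversion_power M P X r l (\<eta> l r)) (\<eta> l r))
        \<le> mse_star M c \<sigma> P X r l + ennreal \<delta>"
    by metis
  define p where "p = (\<lambda>l i r. inversion_power M P X r l (\<eta> l r) i)"
  have "0 \<le> p l i r \<and> p l i r \<le> placed_power M P X l i"
    if l: "l \<in> {1..L}" and r: "r \<in> space ?R" and i: "i \<in> act r l" for l r i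
  proof -
    have "0 \<le> placed_power M P X l j" if "j \<in> act r l" for j
      using act_subset[OF r l] that by (intro placed_power_nonneg[OF X l _ P]) auto
    then have "(inversion_power M P X r l (\<eta> l r), \<eta> l r) \<in> inner_feasible M P X r l"
      using pos[OF l r] by (rule inversion_power_feasible)
    then show ?thesis using i by (simp add: inner_feasible_def p_def)
  qed
  then have feasible: "(X, p, \<eta>) \<in> joint_feasible L I M K P"
    using X \<eta> pos by (simp add: joint_feasible_def p_def measurable_inversion_power)
  have "joint_objective \<Omega> \<rho> L M a c \<sigma> X p \<eta>
      \<le> (\<Sum>l\<in>{1..L}. ennreal (a l) * (\<integral>\<^sup>+ \<omega>. mse_star M c \<sigma> P X (\<rho> \<omega>) l + ennreal \<delta> \<partial>\<Omega>))"
    unfolding joint_objective_def p_def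
    using le measurable_space[OF \<rho>] by (intro sum_mono mult_left_mono nn_integral_mono) auto
  also have "\<dots> = (\<Sum>l\<in>{1..L}. ennreal (a l) * (\<integral>\<^sup>+ \<omega>. mse_star M c \<sigma> P X (\<rho> \<omega>) l \<partial>\<Omega>)
      + ennreal (a l * \<delta>))"
  proof (rule sum.cong[OF refl])
    fix l assume l: "l \<in> {1..L}"
    \<comment> \<open>Additivity of the integral relies on measurability of \<open>mse_star\<close>.
      The constant integrates to \<open>\<delta>\<close> because the total mass is 1.\<close>
    have "(\<lambda>\<omega>. mse_star M c \<sigma> P X (\<rho> \<omega>) l) \<in> borel_measurable \<Omega>"
      using recourse(1) l by (intro measurable_compose[OF \<rho>]) auto
    then show "ennreal (a l) * (\<integral>\<^sup>+ \<omega>. mse_star M c \<sigma> P X (\<rho> \<omega>) l + ennreal \<delta> \<partial>\<Omega>) =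
        ennreal (a l) * (\<integral>\<^sup>+ \<omega>. mse_star M c \<sigma> P X (\<rho> \<omega>) l \<partial>\<Omega>) + ennreal (a l * \<delta>)"
      using a[OF l] \<open>0 < \<delta>\<close>
      by (simp add: nn_integral_add distrib_left ennreal_mult emeasure_space_1)
  qed
  also have "\<dots> = nested_objective \<Omega> \<rho> L M a c \<sigma> P X + ennreal (sum a {1..L} * \<delta>)"
    unfolding nested_objective_def sum.distrib sum_distrib_right
    by (subst sum_ennreal) (use a \<open>0 < \<delta>\<close> in simp_all)
  also have "\<dots> \<le> nested_objective \<Omega> \<rho> L M a c \<sigma> P X + ennreal \<epsilon>"
    using \<delta> by (intro add_left_mono ennreal_leI)
  finally show thesis using that feasible by blast
qed

theorem proposition1:
  fixes \<Omega> :: "'w measure" and \<rho> :: "'w \<Rightarrow> realization"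
    and L I M K :: nat and a c P :: "nat \<Rightarrow> real" and \<sigma> :: real
  assumes "M \<ge> L * I" and "K \<ge> 1"
    and "\<And>l. l \<in> {1..L} \<Longrightarrow> a l \<ge> 0"
    and "\<And>l. l \<in> {1..L} \<Longrightarrow> c l > 0"
    and "\<sigma>\<^sup>2 > 0"
    and "\<And>m. m \<in> {1..M} \<Longrightarrow> P m > 0"
    and "prob_space \<Omega>"
    and "\<rho> \<in> measurable \<Omega> (realization_space L I M K)"
  shows "(INF (X, p, \<eta>)\<in>joint_feasible L I M K P. joint_objective \<Omega> \<rho> L M a c \<sigma> X p \<eta>) =
         (INF X\<in>feasible_placements L I M. nested_objective \<Omega> \<rho> L M a c \<sigma> P X)"
proof (rule antisym)
  show "(INF (X, p, \<eta>)\<in>joint_feasible L I M K P. joint_objective \<Omega> \<rho> L M a c \<sigma> X p \<eta>) \<le>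
      (INF X\<in>feasible_placements L I M. nested_objective \<Omega> \<rho> L M a c \<sigma> P X)"
  proof (rule INF_greatest, rule ennreal_le_epsilon)
    \<comment> \<open>With the placement fixed, an arbitrary slack \<open>\<epsilon>\<close>
      suffices, so no inner minimiser has to exist.\<close>
    fix X and \<epsilon> :: real
    assume X: "X \<in> feasible_placements L I M" and \<epsilon>: "0 < \<epsilon>"
    have P: "0 \<le> P m" if "m \<in> {1..M}" for m using assms(6)[OF that] by simp
    obtain p \<eta> where "(X, p, \<eta>) \<in> joint_feasible L I M K P"
      and "joint_objective \<Omega> \<rho> L M a c \<sigma> X p \<eta> \<le> nested_objective \<Omega> \<rho> L M a c \<sigma> P X + ennreal \<epsilon>"
      by (rule joint_le_nested_objective[OF X P assms(3) \<epsilon> assms(7,8)])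
    then show "(INF (X, p, \<eta>)\<in>joint_feasible L I M K P. joint_objective \<Omega> \<rho> L M a c \<sigma> X p \<eta>) \<le>
        nested_objective \<Omega> \<rho> L M a c \<sigma> P X + ennreal \<epsilon>"
      by (intro INF_lower2) auto
  qed
  show "(INF X\<in>feasible_placements L I M. nested_objective \<Omega> \<rho> L M a c \<sigma> P X) \<le>
      (INF (X, p, \<eta>)\<in>joint_feasible L I M K P. joint_objective \<Omega> \<rho> L M a c \<sigma> X p \<eta>)"
  proof (rule INF_greatest, clarify)
    \<comment> \<open>Conversely, the placement is kept and its recourse is replaced by the inner
      optimum.\<close>
    fix X p \<eta> assume *: "(X, p, \<eta>) \<in> joint_feasible L I M K P"
    then have "X \<in> feasible_placements L I M" by (simp add: joint_feasible_def)
    then show "(INF X\<in>feasible_placements L I M. nested_objective \<Omega> \<rho> L M a c \<sigma> P X) \<le>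
        joint_objective \<Omega> \<rho> L M a c \<sigma> X p \<eta>"
      by (rule INF_lower2) (rule nested_le_joint_objective[OF * assms(8)])
  qed
qed

end
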